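(* For a Tychonoff space $X$ the following are equivalent: (i) $C_p(X)$ is a quasi-$(DF)$-space; (ii) $C_p(X)$ has a fundamental bounded resolution; (iii) $X$ is countable; (iv) $C_p(X)$ belongs to the class $\mathfrak{G}$; (v) $C_p(X)$ has a $\mathfrak{G}$-base.
   Context: $C_p(X)$ is the space of continuous real-valued functions on $X$ with the pointwise topology. Order $\mathbb{N}^{\mathbb{N}}$ pointwise. A resolution is a family $\{A_\alpha:\alpha\in\mathbb{N}^{\mathbb{N}}\}$ covering a set with $A_\alpha\subseteq A_\beta$ whenever $\alpha\le\beta$. A locally convex space $E$ has a fundamental bounded resolution if it has a resolution of bounded sets such that every bounded subset lies in some member. $E$ belongs to the class $\mathfrak{G}$ if there is a resolution of $(E',\sigma(E',E))$ such that every sequence in each member is equicontinuous. $E$ is a quasi-$(DF)$-space if it has a fundamental bounded resolution and belongs to $\mathfrak{G}$. A $\mathfrak{G}$-base is a base of neighbourhoods of zero $\{U_\alpha:\alpha\in\mathbb{N}^{\mathbb{N}}\}$ with $U_\alpha\subseteq U_\beta$ whenever $\beta\le\alpha$. *)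

theory Defs
  imports "HOL-Analysis.Analysis"
begin

definition tychonoff_space :: "'a topology \<Rightarrow> bool" where
  "tychonoff_space X \<longleftrightarrow> completely_regular_space X \<and> Hausdorff_space X"

text \<open>The carrier of C(X): continuous real functions on X, normalised to 0 outside
  the underlying set (so that pointwise vector operations stay inside).\<close>
definition Ccarrier :: "'a topology \<Rightarrow> ('a \<Rightarrow> real) set" where
  "Ccarrier X = {f. continuous_map X euclideanreal f \<and> (\<forall>x. x \<notin> topspace X \<longrightarrow> f x = 0)}"

definition Cp :: "'a topology \<Rightarrow> ('a \<Rightarrow> real) topology" where
  "Cp X = pullback_topology (Ccarrier X) (\<lambda>f. restrict f (topspace X))
            (product_topology (\<lambda>_. euclideanreal) (topspace X))"

text \<open>Generic notions for a locally convex space of real functions E = topspace T with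
  pointwise vector operations (zero vector: the function \<open>\<lambda>_. 0\<close>).\<close>

definition nhd0 :: "('a \<Rightarrow> real) topology \<Rightarrow> ('a \<Rightarrow> real) set \<Rightarrow> bool" where
  "nhd0 T U \<longleftrightarrow> U \<subseteq> topspace T \<and> (\<exists>V. openin T V \<and> (\<lambda>_. 0) \<in> V \<and> V \<subseteq> U)"

definition tvs_bounded :: "('a \<Rightarrow> real) topology \<Rightarrow> ('a \<Rightarrow> real) set \<Rightarrow> bool" where
  "tvs_bounded T B \<longleftrightarrow> B \<subseteq> topspace T \<and>
     (\<forall>U. nhd0 T U \<longrightarrow> (\<exists>s>0. \<forall>t>s. B \<subseteq> (\<lambda>f x. t * f x) ` U))"

definition resolution :: "((nat \<Rightarrow> nat) \<Rightarrow> 'b set) \<Rightarrow> 'b set \<Rightarrow> bool" where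
  "resolution A S \<longleftrightarrow> (\<Union>\<alpha>. A \<alpha>) = S \<and>
     (\<forall>\<alpha> \<beta>. (\<forall>n. \<alpha> n \<le> \<beta> n) \<longrightarrow> A \<alpha> \<subseteq> A \<beta>)"

definition fundamental_bounded_resolution :: "('a \<Rightarrow> real) topology \<Rightarrow> bool" where
  "fundamental_bounded_resolution T \<longleftrightarrow>
     (\<exists>A. resolution A (topspace T) \<and> (\<forall>\<alpha>. tvs_bounded T (A \<alpha>)) \<and>
          (\<forall>B. tvs_bounded T B \<longrightarrow> (\<exists>\<alpha>. B \<subseteq> A \<alpha>)))"

definition tvs_dual :: "('a \<Rightarrow> real) topology \<Rightarrow> (('a \<Rightarrow> real) \<Rightarrow> real) set" where
  "tvs_dual T = {\<phi>. continuous_map T euclideanreal \<phi> \<and>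
      (\<forall>f\<in>topspace T. \<forall>g\<in>topspace T. \<phi> (\<lambda>x. f x + g x) = \<phi> f + \<phi> g) \<and>
      (\<forall>f\<in>topspace T. \<forall>c. \<phi> (\<lambda>x. c * f x) = c * \<phi> f) \<and>
      (\<forall>f. f \<notin> topspace T \<longrightarrow> \<phi> f = 0)}"

definition equicontinuous_set :: "('a \<Rightarrow> real) topology \<Rightarrow> (('a \<Rightarrow> real) \<Rightarrow> real) set \<Rightarrow> bool" where
  "equicontinuous_set T H \<longleftrightarrow> (\<exists>U. nhd0 T U \<and> (\<forall>\<phi>\<in>H. \<forall>f\<in>U. \<bar>\<phi> f\<bar> \<le> 1))"

text \<open>Class G: a resolution of E' (as a set; the weak* topology plays no role in the
  definition) whose members have all sequences equicontinuous.\<close>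
definition class_G :: "('a \<Rightarrow> real) topology \<Rightarrow> bool" where
  "class_G T \<longleftrightarrow> (\<exists>A. resolution A (tvs_dual T) \<and>
      (\<forall>\<alpha> (s::nat \<Rightarrow> ('a \<Rightarrow> real) \<Rightarrow> real). range s \<subseteq> A \<alpha> \<longrightarrow> equicontinuous_set T (range s)))"

definition quasi_DF :: "('a \<Rightarrow> real) topology \<Rightarrow> bool" where
  "quasi_DF T \<longleftrightarrow> fundamental_bounded_resolution T \<and> class_G T"

definition has_G_base :: "('a \<Rightarrow> real) topology \<Rightarrow> bool" where
  "has_G_base T \<longleftrightarrow> (\<exists>U::(nat \<Rightarrow> nat) \<Rightarrow> ('a \<Rightarrow> real) set. (\<forall>\<alpha>. nhd0 T (U \<alpha>)) \<and>
      (\<forall>V. nhd0 T V \<longrightarrow> (\<exists>\<alpha>. U \<alpha> \<subseteq> V)) \<and>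
      (\<forall>\<alpha> \<beta>. (\<forall>n. \<alpha> n \<le> \<beta> n) \<longrightarrow> U \<beta> \<subseteq> U \<alpha>))"

end

theory Submission
  imports Defs
begin

text \<open>
  The two substantial implications both end in the countability of \<open>X\<close>. For a resolution \<open>A\<close> and a
  finite sequence \<open>s\<close>, let \<open>W s\<close> be the union of all \<open>A \<beta>\<close> with \<open>\<beta>\<close> extending \<open>s\<close>. If \<open>x n\<close> lies in
  \<open>W\<close> of the restriction of \<open>\<alpha>\<close> to \<open>n\<close> for every \<open>n\<close>, then a single \<open>A \<gamma>\<close> contains all \<open>x n\<close>.

  Class \<open>\<GG>\<close>: the point evaluations turn a resolution of the dual into a resolution of \<open>X\<close>; its members
  are finite, because an equicontinuous set of evaluations is finite. By the remark above every branch
  \<open>\<alpha>\<close> has a finite \<open>W s\<close>, so \<open>X\<close> is a union of countably many finite sets.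

  Fundamental bounded resolution: by the same remark, for every bounded \<open>B\<close> and every point \<open>x\<close> there
  is an \<open>s\<close> such that \<open>B \<subseteq> W s\<close> and \<open>W s\<close> is bounded at \<open>x\<close>. If \<open>X\<close> is uncountable, some \<open>x\<close> avoids all
  the finite sets among the sets \<open>Y F\<close> of points at which every \<open>W s\<close> with \<open>s \<in> F\<close> is bounded, \<open>F\<close>
  finite. Exhaust the countable set of all \<open>s\<close> with \<open>W s\<close> bounded at \<open>x\<close> by finite sets \<open>F n\<close>, choose
  distinct points \<open>z n\<close> in the infinite sets \<open>Y (F n)\<close>, and pass to a subsequence carrying bumps with
  pairwise disjoint supports. Arbitrary multiples of such bumps are pointwise bounded, and suitable
  multiples lie in no \<open>W s\<close> that is bounded at \<open>x\<close>, a contradiction.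
\<close>

subsection \<open>The topology of pointwise convergence\<close>

lemma Ccarrier_zero: "(\<lambda>_. 0) \<in> Ccarrier X"
  by (simp add: Ccarrier_def)

lemma Ccarrier_scale: "f \<in> Ccarrier X \<Longrightarrow> (\<lambda>x. c * f x) \<in> Ccarrier X"
  by (auto simp: Ccarrier_def intro: continuous_intros)

lemma Ccarrier_add: "f \<in> Ccarrier X \<Longrightarrow> g \<in> Ccarrier X \<Longrightarrow> (\<lambda>x. f x + g x) \<in> Ccarrier X"
  by (auto simp: Ccarrier_def intro: continuous_intros)

lemma topspace_Cp: "topspace (Cp X) = Ccarrier X"
  by (auto simp: Cp_def topspace_pullback_topology)

lemma continuous_map_Cp_eval:
  assumes "x \<in> topspace X"
  shows "continuous_map (Cp X) euclideanreal (\<lambda>f. f x)"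
proof -
  have "continuous_map (Cp X) euclideanreal ((\<lambda>g. g x) \<circ> (\<lambda>f. restrict f (topspace X)))"
    unfolding Cp_def
    by (rule continuous_map_pullback) (use assms in \<open>auto intro: continuous_map_product_projection\<close>)
  then show ?thesis
    by (rule continuous_map_eq) (use assms in auto)
qed

text \<open>A neighbourhood in the product topology restricts only finitely many coordinates, and
  the least of their radii serves all of them.\<close>

lemma nhd0_Cp_iff:
  "nhd0 (Cp X) U \<longleftrightarrow> U \<subseteq> Ccarrier X \<and>
     (\<exists>F e. finite F \<and> F \<subseteq> topspace X \<and> e > 0 \<and> {f \<in> Ccarrier X. \<forall>x\<in>F. \<bar>f x\<bar> < e} \<subseteq> U)"
proof -
  have opens: "\<exists>F e. finite F \<and> F \<subseteq> topspace X \<and> e > 0 \<and> {f \<in> Ccarrier X. \<forall>x\<in>F. \<bar>f x\<bar> < e} \<subseteq> V"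
    if V: "openin (Cp X) V" "(\<lambda>_. 0) \<in> V" for V
  proof -
    obtain W where W: "openin (product_topology (\<lambda>_. euclideanreal) (topspace X)) W"
      and VW: "V = (\<lambda>f. restrict f (topspace X)) -` W \<inter> Ccarrier X"
      using V(1) unfolding Cp_def openin_pullback_topology by blast
    have "restrict (\<lambda>_. 0) (topspace X) \<in> W"
      using V(2) VW by auto
    then have "\<exists>Q. finite {i \<in> topspace X. Q i \<noteq> topspace euclideanreal} \<and>
        (\<forall>i\<in>topspace X. openin euclideanreal (Q i)) \<and>
        restrict (\<lambda>_. 0) (topspace X) \<in> Pi\<^sub>E (topspace X) Q \<and> Pi\<^sub>E (topspace X) Q \<subseteq> W"
      using W unfolding openin_product_topology_alt by (rule bspec[rotated])
    then obtain Q where fin: "finite {i \<in> topspace X. Q i \<noteq> UNIV}"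
      and op: "\<And>i. i \<in> topspace X \<Longrightarrow> open (Q i)"
      and Q0: "restrict (\<lambda>_. 0) (topspace X) \<in> Pi\<^sub>E (topspace X) Q"
      and QW: "Pi\<^sub>E (topspace X) Q \<subseteq> W"
      by auto
    have Q0': "0 \<in> Q i" if "i \<in> topspace X" for i
      using Q0 that by (auto simp: PiE_iff)
    have "\<forall>i \<in> topspace X. \<exists>d>0. \<forall>r. \<bar>r\<bar> < d \<longrightarrow> r \<in> Q i"
    proof
      fix i assume "i \<in> topspace X"
      then obtain d where "d > 0" "ball 0 d \<subseteq> Q i"
        using op Q0' by (meson open_contains_ball)
      then show "\<exists>d>0. \<forall>r. \<bar>r\<bar> < d \<longrightarrow> r \<in> Q i"
        by (intro exI[of _ d]) (auto simp: subset_iff dist_real_def)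
    qed
    then obtain d where d: "\<And>i. i \<in> topspace X \<Longrightarrow> d i > 0"
      "\<And>i r. i \<in> topspace X \<Longrightarrow> \<bar>r\<bar> < d i \<Longrightarrow> r \<in> Q i"
      by metis
    let ?F = "{i \<in> topspace X. Q i \<noteq> UNIV}"
    \<comment> \<open>The inserted \<open>1\<close> keeps \<open>Min\<close> meaningful when no
      coordinate is restricted.\<close>
    define e where "e = Min (insert 1 (d ` ?F))"
    have "e > 0"
      using fin d(1) by (auto simp: e_def)
    have ed: "e \<le> d i" if "i \<in> ?F" for i
      using fin that by (auto simp: e_def)
    have "f \<in> V" if f: "f \<in> Ccarrier X" "\<forall>x\<in>?F. \<bar>f x\<bar> < e" for f
    proof -
      have "f i \<in> Q i" if "i \<in> topspace X" for i
      proof (cases "i \<in> ?F")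
        case True
        then show ?thesis
          using ed[OF True] f(2) d(2)[OF that, of "f i"] by fastforce
      qed (use that in auto)
      then have "restrict f (topspace X) \<in> W"
        using QW by auto
      then show ?thesis
        using f(1) VW by auto
    qed
    with fin \<open>e > 0\<close> show ?thesis
      by (intro exI[of _ ?F] exI[of _ e]) auto
  qed
  have basic: "openin (Cp X) {f \<in> Ccarrier X. \<forall>x\<in>F. \<bar>f x\<bar> < e}"
    if "finite F" "F \<subseteq> topspace X" for F e
  proof -
    \<comment> \<open>An intersection over an empty index set would not be confined to the carrier,
      so \<open>F = {}\<close> is treated apart.\<close>
    have "openin (Cp X) (\<Inter>x\<in>F. {f \<in> topspace (Cp X). f x \<in> {-e<..<e}} )" if "F \<noteq> {}"
      using \<open>finite F\<close> \<open>F \<subseteq> topspace X\<close> that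
      by (intro openin_INT2 openin_continuous_map_preimage[OF continuous_map_Cp_eval]) auto
    moreover have "(\<Inter>x\<in>F. {f \<in> topspace (Cp X). f x \<in> {-e<..<e}})
        = {f \<in> Ccarrier X. \<forall>x\<in>F. \<bar>f x\<bar> < e}" if "F \<noteq> {}"
      using that by (auto simp: topspace_Cp abs_less_iff minus_less_iff)
    ultimately show ?thesis
      using openin_topspace[of "Cp X"] by (cases "F = {}") (auto simp: topspace_Cp)
  qed
  have "(\<exists>V. openin (Cp X) V \<and> (\<lambda>_. 0) \<in> V \<and> V \<subseteq> U) \<longleftrightarrow>
      (\<exists>F e. finite F \<and> F \<subseteq> topspace X \<and> e > 0 \<and> {f \<in> Ccarrier X. \<forall>x\<in>F. \<bar>f x\<bar> < e} \<subseteq> U)"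
    (is "?L \<longleftrightarrow> ?R")
  proof (intro iffI)
    assume ?L
    then obtain V where V: "openin (Cp X) V" "(\<lambda>_. 0) \<in> V" "V \<subseteq> U" by blast
    obtain F e where "finite F" "F \<subseteq> topspace X" "e > 0" "{f \<in> Ccarrier X. \<forall>x\<in>F. \<bar>f x\<bar> < e} \<subseteq> V"
      using opens[OF V(1,2)] by blast
    with V(3) show ?R
      by (intro exI[of _ F] exI[of _ e]) auto
  next
    assume ?R
    then obtain F e where F: "finite F" "F \<subseteq> topspace X" "e > 0"
      "{f \<in> Ccarrier X. \<forall>x\<in>F. \<bar>f x\<bar> < e} \<subseteq> U" by blast
    then show ?L
      by (intro exI[of _ "{f \<in> Ccarrier X. \<forall>x\<in>F. \<bar>f x\<bar> < e}"])
         (simp add: basic Ccarrier_zero)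
  qed
  then show ?thesis
    unfolding nhd0_def topspace_Cp by simp
qed

text \<open>Neighbourhoods restricting a single point yield the pointwise bounds. Conversely a given
  neighbourhood restricts finitely many points, and any factor beyond 1 and the largest
  \<open>M x / e\<close> absorbs \<open>B\<close>.\<close>

lemma tvs_bounded_Cp_iff:
  "tvs_bounded (Cp X) B \<longleftrightarrow>
     B \<subseteq> Ccarrier X \<and> (\<forall>x\<in>topspace X. \<exists>M. \<forall>f\<in>B. \<bar>f x\<bar> \<le> M)"
proof (intro iffI conjI ballI)
  assume B: "tvs_bounded (Cp X) B"
  then show "B \<subseteq> Ccarrier X"
    by (simp add: tvs_bounded_def topspace_Cp)
  fix x assume x: "x \<in> topspace X"
  have "nhd0 (Cp X) {f \<in> Ccarrier X. \<bar>f x\<bar> < 1}"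
    unfolding nhd0_Cp_iff using x by (intro conjI exI[of _ "{x}"] exI[of _ 1]) auto
  then obtain s where s: "s > 0" "\<forall>t>s. B \<subseteq> (\<lambda>f x. t * f x) ` {f \<in> Ccarrier X. \<bar>f x\<bar> < 1}"
    using B unfolding tvs_bounded_def by blast
  then have "B \<subseteq> (\<lambda>f x. (s + 1) * f x) ` {f \<in> Ccarrier X. \<bar>f x\<bar> < 1}"
    by simp
  then have "\<bar>f x\<bar> \<le> s + 1" if "f \<in> B" for f
    using that s(1) by (force simp: abs_mult mult_le_cancel_left1)
  then show "\<exists>M. \<forall>f\<in>B. \<bar>f x\<bar> \<le> M"
    by blast
next
  assume B: "B \<subseteq> Ccarrier X \<and> (\<forall>x\<in>topspace X. \<exists>M. \<forall>f\<in>B. \<bar>f x\<bar> \<le> M)"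
  show "tvs_bounded (Cp X) B"
    unfolding tvs_bounded_def
  proof (intro conjI allI impI)
    show "B \<subseteq> topspace (Cp X)"
      using B by (simp add: topspace_Cp)
    fix U assume "nhd0 (Cp X) U"
    then obtain F e where F: "finite F" "F \<subseteq> topspace X" "e > 0"
      "{f \<in> Ccarrier X. \<forall>x\<in>F. \<bar>f x\<bar> < e} \<subseteq> U"
      unfolding nhd0_Cp_iff by blast
    obtain M where M: "\<And>x f. x \<in> topspace X \<Longrightarrow> f \<in> B \<Longrightarrow> \<bar>f x\<bar> \<le> M x"
      using B by metis
    define s where "s = Max (insert 1 ((\<lambda>x. M x / e) ` F))"
    have "s \<ge> 1" and sM: "\<And>x. x \<in> F \<Longrightarrow> M x / e \<le> s"
      using F(1) by (auto simp: s_def intro!: Max_ge)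
    have "B \<subseteq> (\<lambda>f x. t * f x) ` U" if t: "t > s" for t
    proof
      fix f assume f: "f \<in> B"
      have "\<bar>inverse t * f x\<bar> < e" if "x \<in> F" for x
      proof -
        have "M x / e < t"
          using sM[OF that] t by linarith
        then have "\<bar>f x\<bar> < t * e"
          using M[of x f] f that F by (auto simp: field_simps)
        then show ?thesis
          using t \<open>s \<ge> 1\<close> by (simp add: abs_mult field_simps)
      qed
      then have "(\<lambda>x. inverse t * f x) \<in> U"
        using B f Ccarrier_scale[of f X "inverse t"] by (intro subsetD[OF F(4)]) auto
      moreover have "f = (\<lambda>x. t * (inverse t * f x))"
        using t \<open>s \<ge> 1\<close> by auto
      ultimately show "f \<in> (\<lambda>f x. t * f x) ` U"
        by (intro image_eqI)
    qed
    then show "\<exists>s>0. \<forall>t>s. B \<subseteq> (\<lambda>f x. t * f x) ` U"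
      using \<open>s \<ge> 1\<close> by (intro exI[of _ s]) auto
  qed
qed

subsection \<open>Countable spaces\<close>

text \<open>Over a countable set a decreasing sequence of neighbourhoods is a base at zero; it is
  indexed here by \<open>\<alpha> 0\<close>.\<close>

lemma has_G_base_Cp_if_countable:
  assumes X: "countable (topspace X)"
  shows "has_G_base (Cp X)"
proof -
  let ?n = "to_nat_on (topspace X)"
  define P where "P m = {x \<in> topspace X. ?n x \<le> m}" for m
  define U where "U \<alpha> = {f \<in> Ccarrier X. \<forall>x\<in>P (\<alpha> 0). \<bar>f x\<bar> < 1 / (real (\<alpha> 0) + 1)}"
    for \<alpha> :: "nat \<Rightarrow> nat"
  have finP: "finite (P m)" for m
    by (rule inj_on_finite[of ?n _ "{..m}"])
       (use inj_on_to_nat_on[OF X] in \<open>auto simp: P_def inj_on_def\<close>)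
  show ?thesis
    unfolding has_G_base_def
  proof (intro exI[of _ U] conjI allI impI)
    show "nhd0 (Cp X) (U \<alpha>)" for \<alpha>
      unfolding nhd0_Cp_iff
      by (intro conjI exI[of _ "P (\<alpha> 0)"] exI[of _ "1 / (real (\<alpha> 0) + 1)"])
         (auto simp: finP, auto simp: U_def P_def)
  next
    fix V assume "nhd0 (Cp X) V"
    then obtain F e where F: "finite F" "F \<subseteq> topspace X" "e > 0"
      "{f \<in> Ccarrier X. \<forall>x\<in>F. \<bar>f x\<bar> < e} \<subseteq> V"
      unfolding nhd0_Cp_iff by blast
    obtain k where k: "1 / e < real k"
      using reals_Archimedean2 by blast
    define m where "m = Max (insert k (?n ` F))"
    have "k \<le> m" "\<And>x. x \<in> F \<Longrightarrow> ?n x \<le> m"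
      using F(1) by (auto simp: m_def)
    then have "F \<subseteq> P m"
      using F(2) by (auto simp: P_def)
    moreover have "1 / e < real m + 1"
      using k \<open>k \<le> m\<close> by simp
    then have "1 / (real m + 1) < e"
      using F(3) by (simp add: field_simps)
    ultimately have "U (\<lambda>_. m) \<subseteq> {f \<in> Ccarrier X. \<forall>x\<in>F. \<bar>f x\<bar> < e}"
      by (force simp: U_def)
    then show "\<exists>\<alpha>. U \<alpha> \<subseteq> V"
      using F(4) by blast
  next
    fix \<alpha> \<beta> :: "nat \<Rightarrow> nat" assume "\<forall>n. \<alpha> n \<le> \<beta> n"
    then have "\<alpha> 0 \<le> \<beta> 0" by simp
    then have "P (\<alpha> 0) \<subseteq> P (\<beta> 0)" "1 / (real (\<beta> 0) + 1) \<le> 1 / (real (\<alpha> 0) + 1)"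
      by (auto simp: P_def frac_le)
    then show "U \<beta> \<subseteq> U \<alpha>"
      unfolding U_def by (smt (verit) Collect_mono_iff subsetD)
  qed
qed

text \<open>The polars of the base members form the resolution: they grow as the members shrink,
  every continuous functional is bounded by 1 on some member, and a whole polar is
  equicontinuous.\<close>

lemma class_G_if_has_G_base:
  assumes "has_G_base T"
  shows "class_G T"
proof -
  obtain U :: "(nat \<Rightarrow> nat) \<Rightarrow> ('a \<Rightarrow> real) set" where U: "\<And>\<alpha>. nhd0 T (U \<alpha>)"
      "\<And>V. nhd0 T V \<Longrightarrow> \<exists>\<alpha>. U \<alpha> \<subseteq> V"
      "\<And>\<alpha> \<beta>. (\<forall>n. \<alpha> n \<le> \<beta> n) \<Longrightarrow> U \<beta> \<subseteq> U \<alpha>"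
    using assms unfolding has_G_base_def by blast
  define A where "A \<alpha> = {\<phi> \<in> tvs_dual T. \<forall>f\<in>U \<alpha>. \<bar>\<phi> f\<bar> \<le> 1}" for \<alpha>
  have "\<exists>\<alpha>. \<phi> \<in> A \<alpha>" if \<phi>: "\<phi> \<in> tvs_dual T" for \<phi>
  proof -
    have zero: "(\<lambda>_. 0) \<in> topspace T"
      using U(1) by (auto simp: nhd0_def)
    have "\<forall>f\<in>topspace T. \<forall>c. \<phi> (\<lambda>x. c * f x) = c * \<phi> f"
      using \<phi> by (simp add: tvs_dual_def)
    from bspec[OF this zero] have "\<phi> (\<lambda>_. 0) = 0"
      using spec[of "\<lambda>c. \<phi> (\<lambda>x. c * 0) = c * \<phi> (\<lambda>_. 0)" 0] by simp
    moreover have "openin T {f \<in> topspace T. \<phi> f \<in> {-1<..<1}}"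
      using \<phi> unfolding tvs_dual_def
      by (intro openin_continuous_map_preimage[where Y = euclideanreal]) auto
    ultimately have "nhd0 T {f \<in> topspace T. \<phi> f \<in> {-1<..<1}}"
      using zero unfolding nhd0_def by auto
    then obtain \<alpha> where "U \<alpha> \<subseteq> {f \<in> topspace T. \<phi> f \<in> {-1<..<1}}"
      using U(2) by blast
    then have "\<phi> \<in> A \<alpha>"
      using \<phi> by (force simp: A_def)
    then show ?thesis by blast
  qed
  then have "resolution A (tvs_dual T)"
    unfolding resolution_def using U(3) by (auto simp: A_def) blast
  moreover have "equicontinuous_set T (range s)" if "range s \<subseteq> A \<alpha>"
    for \<alpha> and s :: "nat \<Rightarrow> ('a \<Rightarrow> real) \<Rightarrow> real"
    unfolding equicontinuous_set_def
    using that U(1)[of \<alpha>] by (intro exI[of _ "U \<alpha>"]) (auto simp: A_def)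
  ultimately show ?thesis
    unfolding class_G_def by blast
qed

text \<open>Read along an enumeration of the points, an index \<open>\<alpha>\<close> is an
  integer-valued envelope, and every pointwise bound can be rounded up to one.\<close>

lemma fundamental_bounded_resolution_Cp_if_countable:
  assumes X: "countable (topspace X)"
  shows "fundamental_bounded_resolution (Cp X)"
proof -
  let ?n = "to_nat_on (topspace X)"
  define A where "A \<alpha> = {f \<in> Ccarrier X. \<forall>x\<in>topspace X. \<bar>f x\<bar> \<le> real (\<alpha> (?n x))}"
    for \<alpha> :: "nat \<Rightarrow> nat"
  have fund: "\<exists>\<alpha>. B \<subseteq> A \<alpha>" if "tvs_bounded (Cp X) B" for B
  proof -
    have B: "B \<subseteq> Ccarrier X" and "\<forall>x\<in>topspace X. \<exists>M. \<forall>f\<in>B. \<bar>f x\<bar> \<le> M"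
      using that by (auto simp: tvs_bounded_Cp_iff)
    then obtain M where M: "\<And>x f. x \<in> topspace X \<Longrightarrow> f \<in> B \<Longrightarrow> \<bar>f x\<bar> \<le> M x"
      by metis
    have "\<bar>f x\<bar> \<le> real (nat \<lceil>M (from_nat_into (topspace X) (?n x))\<rceil>)"
      if "f \<in> B" "x \<in> topspace X" for f x
      using M[OF that(2,1)] X that by simp linarith
    then have "B \<subseteq> A (\<lambda>k. nat \<lceil>M (from_nat_into (topspace X) k)\<rceil>)"
      using B by (auto simp: A_def)
    then show ?thesis by blast
  qed
  have bdd: "tvs_bounded (Cp X) (A \<alpha>)" for \<alpha>
    unfolding tvs_bounded_Cp_iff by (auto simp: A_def)
  have "\<exists>\<alpha>. f \<in> A \<alpha>" if "f \<in> Ccarrier X" for f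
    using fund[of "{f}"] that by (auto simp: tvs_bounded_Cp_iff)
  then have "resolution A (topspace (Cp X))"
    unfolding resolution_def topspace_Cp by (auto simp: A_def) (meson of_nat_mono order_trans)
  then show ?thesis
    unfolding fundamental_bounded_resolution_def using fund bdd by blast
qed

subsection \<open>Resolutions along branches of the tree of finite sequences\<close>

text \<open>Finite sequences are encoded as lists, so there are only countably many of these
  unions.\<close>

definition branch_union :: "((nat \<Rightarrow> nat) \<Rightarrow> 'b set) \<Rightarrow> nat list \<Rightarrow> 'b set" where
  "branch_union A s = \<Union> {A \<beta> | \<beta>. map \<beta> [0..<length s] = s}"

lemma subset_branch_union: "A \<alpha> \<subseteq> branch_union A (map \<alpha> [0..<n])"
  by (auto simp: branch_union_def)

text \<open>The members witnessing \<open>x n\<close> have indices agreeing with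
  \<open>\<alpha>\<close> below \<open>n\<close>, so these indices have a common pointwise upper
  bound.\<close>

lemma resolution_member_contains_branch_sequence:
  assumes A: "resolution A S" and x: "\<And>n. x n \<in> branch_union A (map \<alpha> [0..<n])"
  shows "\<exists>\<gamma>. range x \<subseteq> A \<gamma>"
proof -
  have "\<exists>\<beta>. x n \<in> A \<beta> \<and> map \<beta> [0..<n] = map \<alpha> [0..<n]" for n
    using x[of n] by (auto simp: branch_union_def)
  then obtain \<beta> where \<beta>: "\<And>n. x n \<in> A (\<beta> n)" "\<And>n. map (\<beta> n) [0..<n] = map \<alpha> [0..<n]"
    by metis
  then have eq: "\<beta> n k = \<alpha> k" if "k < n" for n k
    using that by (metis atLeastLessThan_iff le0 map_eq_conv set_upt)
  \<comment> \<open>Each coordinate takes only finitely many values along the sequence.\<close>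
  define \<gamma> where "\<gamma> k = Max (insert (\<alpha> k) ((\<lambda>n. \<beta> n k) ` {..k}))" for k
  have "\<beta> n k \<in> insert (\<alpha> k) ((\<lambda>n. \<beta> n k) ` {..k})" for n k
    by (cases "k < n") (auto simp: eq)
  then have "\<beta> n k \<le> \<gamma> k" for n k
    unfolding \<gamma>_def by (intro Max_ge) auto
  then have "A (\<beta> n) \<subseteq> A \<gamma>" for n
    using A unfolding resolution_def by blast
  then show ?thesis
    using \<beta>(1) by blast
qed

lemma injective_choice:
  fixes Y :: "nat \<Rightarrow> 'b set"
  assumes "\<And>n. infinite (Y n)"
  shows "\<exists>x. inj x \<and> (\<forall>n. x n \<in> Y n)"
proof -
  \<comment> \<open>\<open>p n\<close> pairs the current point with a finite set containing all
    points chosen so far.\<close>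
  have "\<exists>p. \<forall>n. (fst (p n) \<in> Y n \<and> finite (snd (p n)) \<and> fst (p n) \<in> snd (p n)) \<and>
      (snd (p n) \<subseteq> snd (p (Suc n)) \<and> fst (p (Suc n)) \<notin> snd (p n))"
  proof (rule dependent_nat_choice)
    obtain y where "y \<in> Y 0"
      using assms[of 0] by (metis finite.emptyI ex_in_conv)
    then show "\<exists>p. fst p \<in> Y 0 \<and> finite (snd p) \<and> fst p \<in> snd p"
      by (intro exI[of _ "(y, {y})"]) auto
  next
    fix p :: "'b \<times> 'b set" and n
    assume p: "fst p \<in> Y n \<and> finite (snd p) \<and> fst p \<in> snd p"
    then obtain y where "y \<in> Y (Suc n)" "y \<notin> snd p"
      using assms[of "Suc n"] by (meson finite_subset subsetI)
    then show "\<exists>q. (fst q \<in> Y (Suc n) \<and> finite (snd q) \<and> fst q \<in> snd q) \<and>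
        snd p \<subseteq> snd q \<and> fst q \<notin> snd p"
      using p by (intro exI[of _ "(y, insert y (snd p))"]) auto
  qed
  then obtain p where p: "\<And>n. fst (p n) \<in> Y n" "\<And>n. fst (p n) \<in> snd (p n)"
    "\<And>n. snd (p n) \<subseteq> snd (p (Suc n))" "\<And>n. fst (p (Suc n)) \<notin> snd (p n)"
    by blast
  have "fst (p m) \<noteq> fst (p n)" if mn: "m < n" for m n
  proof -
    obtain k where k: "n = Suc k" "m \<le> k"
      using mn by (cases n) auto
    then have "snd (p m) \<subseteq> snd (p k)"
      using lift_Suc_mono_le[of "\<lambda>n. snd (p n)"] p(3) by blast
    then show ?thesis
      using p(2)[of m] p(4)[of k] k(1) by auto
  qed
  then have "inj (\<lambda>n. fst (p n))"
    by (intro linorder_injI) auto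
  then show ?thesis
    using p(1) by blast
qed

text \<open>If all unions along a branch were infinite, distinct points chosen from them would share
  one finite member.\<close>

lemma countable_if_resolution_finite:
  assumes A: "resolution A S" and fin: "\<And>\<alpha>. finite (A \<alpha>)"
  shows "countable S"
proof -
  have "\<exists>n. finite (branch_union A (map \<alpha> [0..<n]))" for \<alpha>
  proof (rule ccontr)
    assume "\<nexists>n. finite (branch_union A (map \<alpha> [0..<n]))"
    then obtain x where "inj x" "\<And>n. x n \<in> branch_union A (map \<alpha> [0..<n])"
      using injective_choice[of "\<lambda>n. branch_union A (map \<alpha> [0..<n])"] by blast
    then obtain \<gamma> where "range x \<subseteq> A \<gamma>"
      using resolution_member_contains_branch_sequence[OF A] by blast
    then show False
      using fin \<open>inj x\<close> finite_subset range_inj_infinite by blast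
  qed
  then obtain n where n: "\<And>\<alpha>. finite (branch_union A (map \<alpha> [0..<n \<alpha>]))"
    by metis
  have "S \<subseteq> (\<Union>s \<in> {s. finite (branch_union A s)}. branch_union A s)"
  proof
    fix x assume "x \<in> S"
    then obtain \<alpha> where "x \<in> A \<alpha>"
      using A unfolding resolution_def by blast
    then have "x \<in> branch_union A (map \<alpha> [0..<n \<alpha>])"
      by (rule subsetD[OF subset_branch_union])
    then show "x \<in> (\<Union>s \<in> {s. finite (branch_union A s)}. branch_union A s)"
      using n by (auto intro!: exI[of _ "map \<alpha> [0..<n \<alpha>]"])
  qed
  moreover have "countable (\<Union>s \<in> {s. finite (branch_union A s)}. branch_union A s)"
    by (intro countable_UN) (auto intro: countable_finite)
  ultimately show ?thesis
    using countable_subset by blast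
qed

subsection \<open>Continuous functions on Tychonoff spaces\<close>

lemma tychonoff_separate_finite:
  assumes X: "tychonoff_space X" and F: "finite F" "F \<subseteq> topspace X"
    and y: "y \<in> topspace X" "y \<notin> F"
  obtains f where "f \<in> Ccarrier X" "f y = 1" "\<And>x. x \<in> F \<Longrightarrow> f x = 0"
proof -
  have "closedin X F"
    using X F unfolding tychonoff_space_def
    by (meson Hausdorff_imp_t1_space t1_space_closedin_finite)
  then obtain f where f: "continuous_map X euclideanreal f" "f y = 1" "f ` F \<subseteq> {0}"
    using X y completely_regular_space_gen_alt[of 1 0 X]
    unfolding tychonoff_space_def by (metis DiffI zero_neq_one)
  \<comment> \<open>Extension by zero meets the normalisation in \<open>Ccarrier\<close>.\<close>
  have "(\<lambda>x. if x \<in> topspace X then f x else 0) \<in> Ccarrier X"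
    using f(1) by (auto simp: Ccarrier_def elim: continuous_map_eq)
  then show thesis
    using f y F by (intro that[of "\<lambda>x. if x \<in> topspace X then f x else 0"]) auto
qed

text \<open>A function separating two points of \<open>S\<close> cuts \<open>S\<close> at level 1/2.
  One half is infinite, and the separated point on the other side receives the bump.\<close>

lemma tychonoff_split_infinite:
  assumes X: "tychonoff_space X" and S: "infinite S" "S \<subseteq> topspace X"
  obtains y g h where "y \<in> S" "continuous_map X euclideanreal g" "continuous_map X euclideanreal h"
    "g y \<noteq> 0" "infinite {z \<in> S. h z \<noteq> 0}" "\<And>z. g z * h z = 0"
proof -
  obtain p where p: "p \<in> S"
    using S(1) by (metis finite.emptyI ex_in_conv)
  obtain q where q: "q \<in> S" "q \<noteq> p"
    using S(1) by (metis finite.emptyI finite_insert finite_subset insertI1 subsetI)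
  obtain f where f: "f \<in> Ccarrier X" "f q = 1" "f p = 0"
    using tychonoff_separate_finite[OF X, of "{p}" q] p q S(2) by auto
  have cont: "continuous_map X euclideanreal f"
    using f(1) by (simp add: Ccarrier_def)
  \<comment> \<open>The levels 1/4 and 3/4 lie strictly between 1/2 and the value at the point that
    gets the bump, so the cut-offs are nonzero at that point and on the whole infinite half,
    respectively.\<close>
  let ?u = "\<lambda>x. max 0 (f x - 1/4)" and ?v = "\<lambda>x. max 0 (1/4 - f x)"
  let ?u' = "\<lambda>x. max 0 (f x - 3/4)" and ?v' = "\<lambda>x. max 0 (3/4 - f x)"
  have "S = {z \<in> S. f z \<ge> 1/2} \<union> {z \<in> S. f z < 1/2}"
    by auto
  then consider "infinite {z \<in> S. f z \<ge> 1/2}" | "infinite {z \<in> S. f z < 1/2}"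
    using S(1) by (metis finite_Un)
  then show ?thesis
  proof cases
    case 1
    then have "infinite {z \<in> S. ?u z \<noteq> 0}"
      by (rule contrapos_nn) (auto elim!: rev_finite_subset)
    moreover have "continuous_map X euclideanreal ?v" "continuous_map X euclideanreal ?u"
      using cont by (auto intro!: continuous_intros)
    ultimately show ?thesis
      using p f by (intro that[of p ?v ?u]) (auto simp: max_def)
  next
    case 2
    then have "infinite {z \<in> S. ?v' z \<noteq> 0}"
      by (rule contrapos_nn) (auto elim!: rev_finite_subset)
    moreover have "continuous_map X euclideanreal ?u'" "continuous_map X euclideanreal ?v'"
      using cont by (auto intro!: continuous_intros)
    ultimately show ?thesis
      using q f by (intro that[of q ?u' ?v']) (auto simp: max_def)
  qed
qed

text \<open>Splitting is iterated: each step spends one point on a bump and continues in the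
  infinite remainder. Multiplying by the product of the earlier factors \<open>h\<close> keeps each
  new bump off the earlier ones.\<close>

lemma tychonoff_disjoint_bumps:
  assumes X: "tychonoff_space X" and S: "infinite S" "S \<subseteq> topspace X"
  obtains y :: "nat \<Rightarrow> 'a" and f where "range y \<subseteq> S" "\<And>k. f k \<in> Ccarrier X" "\<And>k. f k (y k) = 1"
    "\<And>k l z. k \<noteq> l \<Longrightarrow> f k z = 0 \<or> f l z = 0"
proof -
  \<comment> \<open>State of the construction: the infinite set from which later points are taken, a function
    without zeros on it that divides all later bumps, the current point and its bump.\<close>
  define P where "P = (\<lambda>(T, H, y :: 'a, g :: 'a \<Rightarrow> real). infinite T \<and> T \<subseteq> S \<and>
      continuous_map X euclideanreal H \<and> (\<forall>z\<in>T. H z \<noteq> (0::real)) \<and>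
      y \<in> S \<and> continuous_map X euclideanreal g \<and> g y \<noteq> 0 \<and> (\<forall>z. g z * H z = 0))"
  define Q where "Q = (\<lambda>(T :: 'a set, H, y :: 'a, g :: 'a \<Rightarrow> real) (T' :: 'a set, H', y' :: 'a, g' :: 'a \<Rightarrow> real).
      \<forall>z. H z = (0::real) \<longrightarrow> H' z = (0::real) \<and> g' z = 0)"
  have step: "\<exists>T' H' y' g'. P (T', H', y', g') \<and> (\<forall>z. H z = 0 \<longrightarrow> H' z = 0 \<and> g' z = 0)"
    if T: "infinite T" "T \<subseteq> S" and H: "continuous_map X euclideanreal H" "\<forall>z\<in>T. H z \<noteq> 0"
    for T and H :: "'a \<Rightarrow> real"
  proof -
    obtain y g h where gh: "y \<in> T" "continuous_map X euclideanreal g"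
        "continuous_map X euclideanreal h" "g y \<noteq> 0" "infinite {z \<in> T. h z \<noteq> 0}"
        "\<And>z. g z * h z = 0"
      by (rule tychonoff_split_infinite[OF X T(1) order_trans[OF T(2) S(2)]]) (rule that; assumption)
    \<comment> \<open>\<open>H\<close> divides both the new bump and its own successor, so its zeros
      persist; \<open>g z * h z = 0\<close> makes the product of these two vanish.\<close>
    have "P ({z \<in> T. h z \<noteq> 0}, \<lambda>z. H z * h z, y, \<lambda>z. H z * g z)"
      using gh T H unfolding P_def by (auto intro: continuous_intros)
    then show ?thesis
      by (intro exI conjI, assumption) auto
  qed
  have "\<exists>p. \<forall>n. P (p n) \<and> Q (p n) (p (Suc n))"
  proof (rule dependent_nat_choice)
    show "\<exists>p. P p"
      using step[OF S(1) subset_refl, of "\<lambda>_. 1"] by auto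
    show "\<exists>q. P q \<and> Q p q" if "P p" for p and n :: nat
    proof -
      obtain T H y g where p: "p = (T, H, y, g)"
        by (cases p)
      have "infinite T" "T \<subseteq> S" "continuous_map X euclideanreal H" "\<forall>z\<in>T. H z \<noteq> 0"
        using that unfolding P_def p by auto
      from step[OF this] obtain T' H' y' g' where "P (T', H', y', g')"
        "\<forall>z. H z = 0 \<longrightarrow> H' z = 0 \<and> g' z = 0"
        by blast
      then show ?thesis
        unfolding p Q_def by (intro exI[of _ "(T', H', y', g')"]) simp
    qed
  qed
  then obtain p where p: "\<And>n. P (p n)" "\<And>n. Q (p n) (p (Suc n))"
    by blast
  define H where "H n = fst (snd (p n))" for n
  define y where "y n = fst (snd (snd (p n)))" for n
  define g where "g n = snd (snd (snd (p n)))" for n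
  have y: "y n \<in> S" and g: "continuous_map X euclideanreal (g n)" "g n (y n) \<noteq> 0"
    and gH: "g n z * H n z = 0" for n z
    using p(1)[of n] unfolding P_def H_def y_def g_def by (auto split: prod.splits)
  have HH: "H n z = 0 \<Longrightarrow> H (Suc n) z = 0" and Hg: "H n z = 0 \<Longrightarrow> g (Suc n) z = 0" for n z
    using p(2)[of n] unfolding Q_def H_def g_def by (auto split: prod.splits)
  have Hm: "H n z = 0" if "H m z = 0" "m \<le> n" for m n z
    using that(2,1) by (induction rule: dec_induct) (auto intro: HH)
  have disj: "g m z = 0 \<or> g n z = 0" if mn: "m < n" for m n z
  proof (cases "g m z = 0")
    case False
    \<comment> \<open>Where bump \<open>m\<close> is nonzero, \<open>H m\<close> vanishes, and every
      later bump inherits this zero.\<close>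
    then have "H m z = 0"
      using gH[of m z] by simp
    moreover obtain k where "n = Suc k" "m \<le> k"
      using mn by (cases n) auto
    ultimately show ?thesis
      using Hg Hm by blast
  qed simp
  define f where "f n z = (if z \<in> topspace X then g n z / g n (y n) else 0)" for n z
  have "f n \<in> Ccarrier X" for n
  proof -
    have "continuous_map X euclideanreal (\<lambda>z. g n z / g n (y n))"
      using g by (intro continuous_map_real_divide) auto
    then have "continuous_map X euclideanreal (f n)"
      by (rule continuous_map_eq) (simp add: f_def)
    then show ?thesis
      by (simp add: Ccarrier_def f_def)
  qed
  moreover have "f n (y n) = 1" for n
    using g(2) y S(2) by (auto simp: f_def)
  moreover have "f k z = 0 \<or> f l z = 0" if "k \<noteq> l" for k l z
    using that disj[of k l z] disj[of l k z] by (auto simp: f_def neq_iff)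
  ultimately show thesis
    using that[of y f] y by blast
qed

subsection \<open>Countability of the underlying space\<close>

lemma countable_if_class_G_Cp:
  assumes X: "tychonoff_space X" and G: "class_G (Cp X)"
  shows "countable (topspace X)"
proof -
  obtain A where A: "resolution A (tvs_dual (Cp X))"
    and eq: "\<And>\<alpha> (s::nat \<Rightarrow> ('a \<Rightarrow> real) \<Rightarrow> real). range s \<subseteq> A \<alpha> \<Longrightarrow> equicontinuous_set (Cp X) (range s)"
    using G unfolding class_G_def by blast
  \<comment> \<open>The value 0 off \<open>Ccarrier X\<close> is the default that
    \<open>tvs_dual\<close> demands.\<close>
  define \<delta> :: "'a \<Rightarrow> ('a \<Rightarrow> real) \<Rightarrow> real" where "\<delta> x f = (if f \<in> Ccarrier X then f x else 0)" for x f
  have dual: "\<delta> x \<in> tvs_dual (Cp X)" if "x \<in> topspace X" for x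
  proof -
    have "continuous_map (Cp X) euclideanreal (\<delta> x)"
      by (rule continuous_map_eq[OF continuous_map_Cp_eval[OF that]]) (simp add: \<delta>_def topspace_Cp)
    then show ?thesis
      by (auto simp: tvs_dual_def topspace_Cp \<delta>_def Ccarrier_add Ccarrier_scale)
  qed
  define D where "D \<alpha> = {x \<in> topspace X. \<delta> x \<in> A \<alpha>}" for \<alpha>
  have res: "resolution D (topspace X)"
    unfolding resolution_def
  proof (intro conjI allI impI)
    have "(\<Union>\<alpha>. A \<alpha>) = tvs_dual (Cp X)"
      using A by (simp add: resolution_def)
    then show "(\<Union>\<alpha>. D \<alpha>) = topspace X"
      using dual by (auto simp: D_def)
    show "D \<alpha> \<subseteq> D \<beta>" if "\<forall>n. \<alpha> n \<le> \<beta> n" for \<alpha> \<beta>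
    proof -
      have "A \<alpha> \<subseteq> A \<beta>"
        using A that by (simp add: resolution_def)
      then show ?thesis
        by (auto simp: D_def)
    qed
  qed
  have "finite (D \<alpha>)" for \<alpha>
  proof (rule ccontr)
    assume "infinite (D \<alpha>)"
    then obtain x :: "nat \<Rightarrow> 'a" where x: "inj x" "range x \<subseteq> D \<alpha>"
      using infinite_countable_subset by blast
    then have "range (\<delta> \<circ> x) \<subseteq> A \<alpha>"
      by (auto simp: D_def)
    from eq[OF this] obtain U where U: "nhd0 (Cp X) U" "\<And>n f. f \<in> U \<Longrightarrow> \<bar>\<delta> (x n) f\<bar> \<le> 1"
      unfolding equicontinuous_set_def by auto
    then obtain F e where F: "finite F" "F \<subseteq> topspace X" "e > 0"
      "{f \<in> Ccarrier X. \<forall>x\<in>F. \<bar>f x\<bar> < e} \<subseteq> U"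
      unfolding nhd0_Cp_iff by blast
    \<comment> \<open>The neighbourhood restricts only the finite set \<open>F\<close>, so a
      function vanishing on \<open>F\<close> with value 2 at \<open>x n\<close> lies in
      \<open>U\<close> and violates the bound 1.\<close>
    obtain n where n: "x n \<notin> F"
      using x(1) F(1) by (meson finite_subset image_subsetI range_inj_infinite)
    obtain f where f: "f \<in> Ccarrier X" "f (x n) = 1" "\<And>z. z \<in> F \<Longrightarrow> f z = 0"
      using tychonoff_separate_finite[OF X F(1,2) _ n] x(2) unfolding D_def by blast
    have "(\<lambda>z. 2 * f z) \<in> U"
      using f F Ccarrier_scale[OF f(1)] by auto
    then show False
      using U(2)[of "\<lambda>z. 2 * f z" n] f Ccarrier_scale[OF f(1)] by (simp add: \<delta>_def)
  qed
  then show ?thesis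
    using countable_if_resolution_finite[OF res] by blast
qed

lemma countable_if_fundamental_bounded_resolution_Cp:
  assumes X: "tychonoff_space X" and R: "fundamental_bounded_resolution (Cp X)"
  shows "countable (topspace X)"
proof (rule ccontr)
  assume unc: "uncountable (topspace X)"
  obtain A where A: "resolution A (Ccarrier X)" and bdd: "\<And>\<alpha>. tvs_bounded (Cp X) (A \<alpha>)"
    and fund: "\<And>B. tvs_bounded (Cp X) B \<Longrightarrow> \<exists>\<alpha>. B \<subseteq> A \<alpha>"
    using R unfolding fundamental_bounded_resolution_def topspace_Cp by blast
  define W where "W = branch_union A"
  define bdd_at where "bdd_at s x \<longleftrightarrow> (\<exists>M. \<forall>f \<in> W s. \<bar>f x\<bar> \<le> M)" for s and x :: 'a
  have local: "\<exists>s. B \<subseteq> W s \<and> bdd_at s x" if B: "tvs_bounded (Cp X) B" and x: "x \<in> topspace X" for B x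
  proof -
    obtain \<alpha> where \<alpha>: "B \<subseteq> A \<alpha>"
      using fund[OF B] by blast
    have "\<exists>n. bdd_at (map \<alpha> [0..<n]) x"
    proof (rule ccontr)
      assume "\<nexists>n. bdd_at (map \<alpha> [0..<n]) x"
      \<comment> \<open>Functions exceeding \<open>n\<close> at \<open>x\<close> would all end up in
        one \<open>A \<gamma>\<close>, which is bounded at \<open>x\<close>.\<close>
      then have "\<forall>n. \<exists>f \<in> W (map \<alpha> [0..<n]). \<bar>f x\<bar> > real n"
        unfolding bdd_at_def by (meson not_le)
      then obtain f where f: "\<And>n. f n \<in> W (map \<alpha> [0..<n])" "\<And>n. \<bar>f n x\<bar> > real n"
        by metis
      then obtain \<gamma> where "range f \<subseteq> A \<gamma>"
        using resolution_member_contains_branch_sequence[OF A] unfolding W_def by blast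
      then obtain M where "\<And>n. \<bar>f n x\<bar> \<le> M"
        using bdd[of \<gamma>] x unfolding tvs_bounded_Cp_iff by blast
      then show False
        using f(2) by (meson less_le_not_le order.trans reals_Archimedean2)
    qed
    then show ?thesis
      using \<alpha> subset_branch_union[of A \<alpha>] unfolding W_def by blast
  qed
  define Y where "Y F = {x \<in> topspace X. \<forall>s\<in>F. bdd_at s x}" for F
  \<comment> \<open>There are countably many finite sets \<open>F\<close> of lists, so the finite
    sets \<open>Y F\<close> cover only countably many points; \<open>x\<close> is chosen
    outside.\<close>
  have "countable (\<Union>F \<in> {F. finite F \<and> finite (Y F)}. Y F)"
    by (intro countable_UN countable_subset[OF _ countable_Collect_finite])
       (auto intro: countable_finite)
  then obtain x where x: "x \<in> topspace X" and xY: "\<And>F. finite F \<Longrightarrow> x \<in> Y F \<Longrightarrow> infinite (Y F)"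
    using unc by (smt (verit) UN_I countable_subset mem_Collect_eq subsetI)
  define F where "F n = {s. bdd_at s x \<and> to_nat s \<le> n}" for n
  have finF: "finite (F n)" for n
    by (rule inj_on_finite[of to_nat _ "{..n}"]) (auto simp: F_def intro: inj_on_subset[OF inj_to_nat])
  \<comment> \<open>\<open>x\<close> itself lies in \<open>Y (F n)\<close>, which is therefore
    infinite by the choice of \<open>x\<close>.\<close>
  have "infinite (Y (F n))" for n
    using x by (intro xY finF) (auto simp: Y_def F_def)
  then obtain z where z: "inj z" "\<And>n. z n \<in> Y (F n)"
    using injective_choice[of "\<lambda>n. Y (F n)"] by blast
  have "\<exists>M. \<forall>f \<in> (\<Union>s\<in>F n. W s). \<bar>f (z n)\<bar> \<le> M" for n
  proof -
    have "\<forall>s\<in>F n. \<exists>M. \<forall>f \<in> W s. \<bar>f (z n)\<bar> \<le> M"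
      using z(2)[of n] by (auto simp: Y_def bdd_at_def)
    then obtain M where M: "\<And>s f. s \<in> F n \<Longrightarrow> f \<in> W s \<Longrightarrow> \<bar>f (z n)\<bar> \<le> M s"
      by metis
    have "\<bar>f (z n)\<bar> \<le> Max (M ` F n)" if "s \<in> F n" "f \<in> W s" for s f
      using M[OF that] finF that(1) by (meson Max_ge finite_imageI image_eqI order_trans)
    then show ?thesis
      by blast
  qed
  then obtain M where M: "\<And>n s f. s \<in> F n \<Longrightarrow> f \<in> W s \<Longrightarrow> \<bar>f (z n)\<bar> \<le> M n"
    by (metis UN_I)
  have "infinite (range z)" "range z \<subseteq> topspace X"
    using z range_inj_infinite by (auto simp: Y_def)
  then obtain y :: "nat \<Rightarrow> 'a" and f where y: "range y \<subseteq> range z"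
    and f: "\<And>k. f k \<in> Ccarrier X" "\<And>k. f k (y k) = 1"
    and disj: "\<And>k l u. k \<noteq> l \<Longrightarrow> f k u = 0 \<or> f l u = 0"
    using tychonoff_disjoint_bumps[OF X] by metis
  have "\<forall>k. \<exists>m. y k = z m"
    using y by auto
  then obtain m where m: "\<And>k. y k = z (m k)"
    by metis
  \<comment> \<open>Two distinct bumps cannot both take the value 1 at a common point
    \<open>y k = y l\<close>.\<close>
  have "inj m"
  proof (rule injI)
    fix k l assume "m k = m l"
    then have "y k = y l"
      using m by simp
    then show "k = l"
      using disj[of k l "y k"] f(2)[of k] f(2)[of l] by auto
  qed
  \<comment> \<open>The height at \<open>z (m k)\<close> exceeds every value attained there by a
    member of some \<open>W s\<close> with \<open>s\<close> in \<open>F (m k)\<close>.\<close>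
  define g where "g k u = (\<bar>M (m k)\<bar> + 1) * f k u" for k u
  have "tvs_bounded (Cp X) (range g)"
    unfolding tvs_bounded_Cp_iff
  proof (intro conjI ballI)
    show "range g \<subseteq> Ccarrier X"
      using Ccarrier_scale[OF f(1)] unfolding g_def by auto
    fix u
    \<comment> \<open>At most one bump is nonzero at \<open>u\<close>, so the heights may be
      arbitrary.\<close>
    show "\<exists>N. \<forall>h\<in>range g. \<bar>h u\<bar> \<le> N"
    proof (cases "\<exists>k. f k u \<noteq> 0")
      case True
      then obtain k where "f k u \<noteq> 0" by blast
      then have "g l u = 0" if "l \<noteq> k" for l
        using disj[OF that, of u] by (simp add: g_def)
      then have "\<bar>g l u\<bar> \<le> \<bar>g k u\<bar>" for l
        by (cases "l = k") auto
      then show ?thesis by blast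
    qed (auto simp: g_def)
  qed
  then obtain s where s: "range g \<subseteq> W s" "bdd_at s x"
    using local x by blast
  \<comment> \<open>An injective \<open>m\<close> is unbounded, so \<open>s\<close> lies in
    \<open>F (m k)\<close> for some \<open>k\<close>.\<close>
  obtain k where "m k \<ge> to_nat s"
    using \<open>inj m\<close> by (metis (no_types, lifting) finite_nat_set_iff_bounded linorder_le_cases not_less
        range_inj_infinite rangeE)
  then have "\<bar>g k (z (m k))\<bar> \<le> M (m k)"
    using s by (intro M[of s]) (auto simp: F_def)
  then show False
    using f(2)[of k] m[of k] by (simp add: g_def)
qed

theorem theorem4p7:
  fixes X :: "'a topology"
  assumes "tychonoff_space X"
  shows "(quasi_DF (Cp X) \<longleftrightarrow> countable (topspace X)) \<and>
         (fundamental_bounded_resolution (Cp X) \<longleftrightarrow> countable (topspace X)) \<and>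
         (class_G (Cp X) \<longleftrightarrow> countable (topspace X)) \<and>
         (has_G_base (Cp X) \<longleftrightarrow> countable (topspace X))"
  \<comment> \<open>Countability gives a base, the base gives class G, and class G gives
    countability back; bounded resolutions are equivalent to countability directly.\<close>
  using has_G_base_Cp_if_countable[of X] class_G_if_has_G_base[of "Cp X"]
    fundamental_bounded_resolution_Cp_if_countable[of X]
    countable_if_class_G_Cp[OF assms] countable_if_fundamental_bounded_resolution_Cp[OF assms]
  unfolding quasi_DF_def by blast

end
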